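(* Let $\xi \in \mathbb{F}_q((T^{-1})) \setminus \mathbb{F}_q(T)$ and let $\alpha \in \mathbb{F}_q((T^{-1}))$ with $\alpha \notin \mathbb{F}_q[T] + \mathbb{F}_q[T]\,\xi$. Then there exist infinitely many nonzero polynomials $Q \in \mathbb{F}_q[T]$ such that \[ \| Q\xi - \alpha \| \leq \frac{1}{q^2 |Q|}. \] Moreover, the factor $q^2$ is best possible: there exists $\xi \in T^{-1}\mathbb{F}_q[[T^{-1}]] \setminus \mathbb{F}_q(T)$ such that \[ \| Q\xi - T^{-1}(1-\xi) \| \geq \frac{1}{q^2 |Q|} \] for every $Q \in \mathbb{F}_q[T] \setminus \{0\}$.
   Context: $q$ is a prime power, $\mathbb{F}_q$ the field with $q$ elements, $\mathbb{F}_q[T]$ the polynomial ring and $\mathbb{F}_q(T)$ its fraction field. $\mathbb{F}_q((T^{-1}))$ is the field of formal Laurent series $x=\sum_{i\ge -n} a_i T^{-i}$ with $a_i\in\mathbb{F}_q$; for $x\neq 0$ with $a_{-n}\ne 0$ the first nonzero coefficient, $\deg x = n$ and $|x| = q^{n}$; $|0|=0$. $T^{-1}\mathbb{F}_q[[T^{-1}]]$ is the set of $x$ with $|x|<1$. For $x \in \mathbb{F}_q((T^{-1}))$, $[x]$ denotes the unique polynomial $P$ with $|x-P|<1$, and $\|x\| := |x - [x]|$ (the distance from $x$ to the nearest polynomial). *)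

theory Defs
  imports
    "HOL-Library.Cardinality"
    "HOL-Computational_Algebra.Polynomial"
    "HOL-Computational_Algebra.Formal_Laurent_Series"
begin

text \<open>
  The finite field is a type \<open>'a :: {finite, field}\<close>, so \<open>q = CARD('a)\<close>. The field of Laurent series
  in \<open>1/T\<close> is \<open>'a fls\<close> with the library's formal variable read as \<open>1/T\<close>: thus \<open>fls_X\<close> is \<open>1/T\<close>,
  \<open>fls_X_inv\<close> is \<open>T\<close>, the coefficient \<open>fls_nth x i\<close> belongs to the power \<open>-i\<close> of \<open>T\<close>, and the degree
  in \<open>T\<close> is the negated subdegree.
\<close>

definition of_poly_T :: "'a::field poly \<Rightarrow> 'a fls" where
  "of_poly_T P = poly (map_poly fls_const P) fls_X_inv"

definition rat_funs_T :: "'a::field fls set" where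
  "rat_funs_T = {of_poly_T P / of_poly_T Q | P Q. Q \<noteq> 0}"

definition deg_T :: "'a::zero fls \<Rightarrow> int" where
  "deg_T x = - fls_subdegree x"

definition fls_abs :: "'a::{finite, field} fls \<Rightarrow> real" where
  "fls_abs x = (if x = 0 then 0 else real CARD('a) powi deg_T x)"

definition nearest_poly :: "'a::{finite, field} fls \<Rightarrow> 'a poly" where
  "nearest_poly x = (THE P. fls_abs (x - of_poly_T P) < 1)"

definition dist_poly :: "'a::{finite, field} fls \<Rightarrow> real" where
  "dist_poly x = fls_abs (x - of_poly_T (nearest_poly x))"

lemma of_poly_T_pCons:
  "of_poly_T (pCons c P) = fls_const c + fls_X_inv * of_poly_T P"
  by (simp add: of_poly_T_def map_poly_pCons)

lemma of_poly_T_nth: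
  "fls_nth (of_poly_T P) i = (if i \<le> 0 then coeff P (nat (- i)) else 0)"
proof (induction P arbitrary: i)
  case 0
  show ?case by (simp add: of_poly_T_def)
next
  case (pCons c P)
  show ?case
  proof (cases "i < 0")
    case True
    then have "nat (- i) = Suc (nat (- (i + 1)))" by simp
    with True show ?thesis
      by (simp add: of_poly_T_pCons fls_X_inv_times_conv_shift pCons.IH)
  next
    case False
    then show ?thesis
      by (auto simp: of_poly_T_pCons fls_X_inv_times_conv_shift pCons.IH)
  qed
qed

lemma fls_abs_less_1_iff:
  fixes x :: "'a::{finite, field} fls"
  shows "fls_abs x < 1 \<longleftrightarrow> (\<forall>i\<le>0. fls_nth x i = 0)"
proof (cases "x = 0")
  case True
  then show ?thesis by (simp add: fls_abs_def)
next
  case False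
  have "card {0, 1 :: 'a} \<le> CARD('a)" by (intro card_mono) auto
  then have q: "real CARD('a) > 1" by simp
  have "fls_abs x < 1 \<longleftrightarrow> 0 < fls_subdegree x"
  proof (cases "0 < fls_subdegree x")
    case True
    then have "real CARD('a) ^ nat (fls_subdegree x) > 1"
      using q by (intro one_less_power) auto
    with True False show ?thesis
      by (simp add: fls_abs_def deg_T_def power_int_def field_simps)
  next
    case neg: False
    then have "real CARD('a) ^ nat (- fls_subdegree x) \<ge> 1"
      using q by (intro one_le_power) auto
    then have "\<not> real CARD('a) ^ nat (- fls_subdegree x) < 1" by linarith
    with neg False show ?thesis
      by (simp add: fls_abs_def deg_T_def power_int_def del: of_nat_power)
  qed
  also have "\<dots> \<longleftrightarrow> (\<forall>i\<le>0. fls_nth x i = 0)"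
    using False nth_fls_subdegree_nonzero[OF False]
    by (metis fls_eq0_below_subdegree le_less_trans not_le)
  finally show ?thesis .
qed

text \<open>The description operator in \<^const>\<open>nearest_poly\<close> is well-defined.\<close>

lemma ex1_nearest_poly:
  fixes x :: "'a::{finite, field} fls"
  shows "\<exists>!P. fls_abs (x - of_poly_T P) < 1"
proof
  define P where "P = pCons (fls_nth x 0) (poly_shift 1 (fls_prpart x))"
  show "fls_abs (x - of_poly_T P) < 1"
    by (auto simp: fls_abs_less_1_iff of_poly_T_nth P_def coeff_pCons coeff_poly_shift
             split: nat.split intro!: arg_cong[where f = "fls_nth x"])
next
  fix R :: "'a poly"
  assume R: "fls_abs (x - of_poly_T R) < 1"
  have "coeff R n = fls_nth x (- int n)" for n
    using R[unfolded fls_abs_less_1_iff, rule_format, of "- int n"]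
    by (simp add: of_poly_T_nth)
  then show "R = pCons (fls_nth x 0) (poly_shift 1 (fls_prpart x))"
    by (intro poly_eqI) (auto simp: coeff_pCons coeff_poly_shift split: nat.split)
qed

end

theory Submission
  imports Defs
begin

text \<open>
  First part: if no nonzero polynomial \<open>R\<close> of degree less than \<open>m\<close> has \<open>\<parallel>R \<xi>\<parallel> < q\<^bsup>-m\<^esup>\<close>, then
  sending \<open>Q\<close> to the first \<open>m\<close> fractional coefficients of \<open>Q \<xi>\<close> is an injection between sets of
  the same size \<open>q\<^bsup>m\<^esup>\<close>, hence some \<open>Q\<close> of degree less than \<open>m\<close> satisfies
  \<open>\<parallel>Q \<xi> - \<alpha>\<parallel> \<le> q\<^bsup>-m-1\<^esup>\<close>. Such \<open>m\<close> are unbounded: take \<open>Q\<close> of minimal degree among the nonzero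
  polynomials with \<open>\<parallel>Q \<xi>\<parallel>\<close> below a given bound, and \<open>m\<close> with \<open>\<parallel>Q \<xi>\<parallel> = q\<^bsup>-m\<^esup>\<close>.

  Second part: let \<open>\<xi>\<close> be the root of \<open>x\<^sup>2 + T x = 1\<close> with \<open>|\<xi>| < 1\<close>. Multiplying by \<open>T\<close> turns the
  claim into \<open>|B| |A - B \<xi>| \<ge> 1\<close> for \<open>A = T P + 1\<close> and \<open>B = T Q + 1\<close>. Otherwise the norm
  \<open>A\<^sup>2 + T A B - B\<^sup>2\<close> of \<open>A - B \<xi>\<close> would have absolute value less than \<open>q\<close>; being divisible by
  \<open>T\<close>, it would vanish, and \<open>\<xi>\<close> would be rational.
\<close>

section \<open>Polynomials inside the Laurent series and the absolute value\<close>

lemma fls_X_inv_times_X: "fls_X_inv * fls_X = (1 :: 'a::field fls)"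
  by (simp add: fls_X_inv_times_conv_shift fls_X_conv_shift_1)

lemma of_poly_T_0 [simp]: "of_poly_T 0 = 0"
  by (simp add: of_poly_T_def)

lemma of_poly_T_add: "of_poly_T (P + Q) = of_poly_T P + of_poly_T Q"
  by (rule fls_eqI) (simp add: of_poly_T_nth)

lemma of_poly_T_diff: "of_poly_T (P - Q) = of_poly_T P - of_poly_T Q"
  by (rule fls_eqI) (simp add: of_poly_T_nth)

lemma of_poly_T_smult: "of_poly_T (smult c P) = fls_const c * of_poly_T P"
  by (rule fls_eqI) (simp add: of_poly_T_nth)

lemma of_poly_T_mult: "of_poly_T (P * Q) = of_poly_T P * of_poly_T Q"
proof (induction P)
  case (pCons c P)
  then show ?case
    by (simp add: of_poly_T_pCons of_poly_T_add of_poly_T_smult algebra_simps)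
qed simp

lemma of_poly_T_eq_0_iff [simp]: "of_poly_T P = 0 \<longleftrightarrow> P = 0"
proof
  assume "of_poly_T P = 0"
  then have "coeff P n = 0" for n
    using of_poly_T_nth[of P "- int n"] by simp
  then show "P = 0" by (intro poly_eqI) simp
qed simp

lemma rat_funs_T_I:
  assumes "B \<noteq> 0" "of_poly_T B * x = of_poly_T A"
  shows "x \<in> rat_funs_T"
proof -
  have "x = of_poly_T A / of_poly_T B"
    using assms by (simp add: field_simps)
  then show ?thesis
    using assms(1) unfolding rat_funs_T_def by blast
qed

lemma one_less_card_field: "1 < real CARD('a::{finite, field})"
proof -
  have "card {0, 1 :: 'a} \<le> CARD('a)" by (intro card_mono) auto
  then show ?thesis by simp
qed

lemma power_int_le_iff_exp:
  fixes a :: "'a::linordered_field"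
  assumes "1 < a"
  shows "a powi i \<le> a powi j \<longleftrightarrow> i \<le> j"
  using power_int_increasing[of i j a] power_int_strict_increasing[of j i a] assms
  by (meson less_le_not_le not_le)

lemma fls_abs_mult: "fls_abs (x * y) = fls_abs x * fls_abs (y :: 'a::{finite, field} fls)"
  using one_less_card_field[where 'a = 'a]
  by (auto simp: fls_abs_def deg_T_def power_int_add[symmetric])

lemma fls_abs_nonneg: "0 \<le> fls_abs (x :: 'a::{finite, field} fls)"
  by (simp add: fls_abs_def)

lemma fls_abs_pos_iff: "0 < fls_abs x \<longleftrightarrow> (x :: 'a::{finite, field} fls) \<noteq> 0"
  using one_less_card_field[where 'a = 'a] by (simp add: fls_abs_def)

lemma fls_abs_minus: "fls_abs (- x) = fls_abs (x :: 'a::{finite, field} fls)"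
  by (simp add: fls_abs_def deg_T_def)

lemma fls_abs_X_inv: "fls_abs (fls_X_inv :: 'a::{finite, field} fls) = real CARD('a)"
  by (simp add: fls_abs_def deg_T_def)

text \<open>Trades size bounds for vanishing coefficients, which makes the ultrametric inequality
  immediate and later allows counting.\<close>

lemma fls_abs_le_powi_iff:
  fixes x :: "'a::{finite, field} fls"
  shows "fls_abs x \<le> real CARD('a) powi (- k) \<longleftrightarrow> (\<forall>i<k. fls_nth x i = 0)"
proof (cases "x = 0")
  case False
  have q: "1 < real CARD('a)" by (rule one_less_card_field)
  have "fls_abs x \<le> real CARD('a) powi (- k) \<longleftrightarrow> k \<le> fls_subdegree x"
    using False q by (simp add: fls_abs_def deg_T_def power_int_le_iff_exp)
  also have "\<dots> \<longleftrightarrow> (\<forall>i<k. fls_nth x i = 0)"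
    using False by (metis fls_eq0_below_subdegree fls_subdegree_geI nth_fls_subdegree_nonzero
        order_less_le_trans not_le)
  finally show ?thesis .
qed (simp add: fls_abs_def)

lemma fls_abs_add_le:
  fixes x y :: "'a::{finite, field} fls"
  shows "fls_abs (x + y) \<le> max (fls_abs x) (fls_abs y)"
proof -
  have *: "fls_abs (u + w) \<le> fls_abs w" if "fls_abs u \<le> fls_abs w" for u w :: "'a fls"
  proof (cases "w = 0")
    case True
    then have "u = 0" using that fls_abs_pos_iff[of u] by (auto simp: fls_abs_def)
    with True show ?thesis by simp
  next
    case False
    then have w: "fls_abs w = real CARD('a) powi (- fls_subdegree w)"
      by (simp add: fls_abs_def deg_T_def)
    then show ?thesis using that unfolding w fls_abs_le_powi_iff by simp
  qed
  show ?thesis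
    using *[of x y] *[of y x] by (cases "fls_abs x \<le> fls_abs y") (auto simp: add.commute)
qed

lemma fls_abs_of_poly_T:
  fixes Q :: "'a::{finite, field} poly"
  assumes "Q \<noteq> 0"
  shows "fls_abs (of_poly_T Q) = real CARD('a) ^ degree Q"
proof -
  have "fls_subdegree (of_poly_T Q) = - int (degree Q)"
    using assms by (intro fls_subdegree_eqI) (auto simp: of_poly_T_nth coeff_eq_0)
  then show ?thesis using assms by (simp add: fls_abs_def deg_T_def)
qed

text \<open>Discreteness of polynomials, the analogue of an integer of absolute value below 1 being
  zero. Both halves of the theorem end in this step.\<close>

lemma of_poly_T_abs_less_1D:
  fixes P :: "'a::{finite, field} poly"
  assumes "fls_abs (of_poly_T P) < 1"
  shows "P = 0"
proof (rule ccontr)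
  assume "P \<noteq> 0"
  then show False
    using assms one_le_power[of "real CARD('a)" "degree P"] one_less_card_field[where 'a = 'a]
    unfolding fls_abs_of_poly_T[OF \<open>P \<noteq> 0\<close>] by linarith
qed

section \<open>Distance to the nearest polynomial\<close>

lemma fls_abs_diff_nearest_poly:
  fixes x :: "'a::{finite, field} fls"
  shows "fls_abs (x - of_poly_T (nearest_poly x)) < 1"
  unfolding nearest_poly_def by (rule theI'[OF ex1_nearest_poly])

text \<open>Subtracting the nearest polynomial clears the coefficients at indices up to 0 and keeps
  the others, so the bound amounts to \<open>n\<close> linear conditions.\<close>

lemma dist_poly_le_powi_iff:
  fixes x :: "'a::{finite, field} fls"
  shows "dist_poly x \<le> real CARD('a) powi (- int n - 1) \<longleftrightarrow>
           (\<forall>i\<in>{1..n}. fls_nth x (int i) = 0)"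
proof -
  define y where "y = x - of_poly_T (nearest_poly x)"
  have y: "fls_nth y i = (if i \<le> 0 then 0 else fls_nth x i)" for i
    using fls_abs_diff_nearest_poly[of x, unfolded fls_abs_less_1_iff]
    by (auto simp: y_def of_poly_T_nth)
  have "dist_poly x \<le> real CARD('a) powi (- int n - 1) \<longleftrightarrow> (\<forall>i<int n + 1. fls_nth y i = 0)"
    using fls_abs_le_powi_iff[of y "int n + 1"] by (simp add: dist_poly_def y_def)
  also have "\<dots> \<longleftrightarrow> (\<forall>i\<in>{1..n}. fls_nth x (int i) = 0)"
  proof safe
    fix i assume "\<forall>i<int n + 1. fls_nth y i = 0" "i \<in> {1..n}"
    then show "fls_nth x (int i) = 0" using y[of "int i"] by auto
  next
    fix i assume *: "\<forall>i\<in>{1..n}. fls_nth x (int i) = 0" "i < int n + 1"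
    show "fls_nth y i = 0"
    proof (cases "i \<le> 0")
      case False
      then have "nat i \<in> {1..n}" using *(2) by auto
      with *(1) have "fls_nth x (int (nat i)) = 0" by blast
      with False show ?thesis using y[of i] by simp
    qed (simp add: y)
  qed
  finally show ?thesis .
qed

lemma dist_poly_pos:
  assumes "\<And>P. x \<noteq> of_poly_T P"
  shows "0 < dist_poly x"
  using assms by (simp add: dist_poly_def fls_abs_pos_iff)

section \<open>Counting polynomials of bounded degree\<close>

text \<open>Bounding coefficients instead of requiring \<open>degree P < n\<close> keeps the zero
  polynomial in the set when \<open>n = 0\<close>.\<close>

lemma bij_betw_coeffs:
  "bij_betw (\<lambda>P :: 'a::zero poly. restrict (coeff P) {..<n}) {P. \<forall>i\<ge>n. coeff P i = 0}
     ({..<n} \<rightarrow>\<^sub>E UNIV)"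
proof (rule bij_betwI')
  fix P Q :: "'a poly"
  assume "P \<in> {P. \<forall>i\<ge>n. coeff P i = 0}" "Q \<in> {P. \<forall>i\<ge>n. coeff P i = 0}"
  then show "(restrict (coeff P) {..<n} = restrict (coeff Q) {..<n}) = (P = Q)"
    by (auto simp: poly_eq_iff fun_eq_iff restrict_def) (metis not_le)
next
  fix f :: "nat \<Rightarrow> 'a"
  assume f: "f \<in> {..<n} \<rightarrow>\<^sub>E UNIV"
  define g where "g = (\<lambda>i. if i < n then f i else 0)"
  have "coeff (Abs_poly g) = g"
    by (intro coeff_Abs_poly[of n]) (simp add: g_def)
  then show "\<exists>P\<in>{P. \<forall>i\<ge>n. coeff P i = 0}. f = restrict (coeff P) {..<n}"
    using f by (intro bexI[of _ "Abs_poly g"]) (auto simp: g_def fun_eq_iff PiE_def extensional_def)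
qed auto

lemma card_polys_bounded:
  "finite {P :: 'a::{finite, zero} poly. \<forall>i\<ge>n. coeff P i = 0}"
  "card {P :: 'a::{finite, zero} poly. \<forall>i\<ge>n. coeff P i = 0} = CARD('a) ^ n"
  using bij_betw_finite[OF bij_betw_coeffs[where 'a = 'a and n = n]]
    bij_betw_same_card[OF bij_betw_coeffs[where 'a = 'a and n = n]]
  by (simp_all add: finite_PiE card_PiE)

section \<open>Homogeneous approximation\<close>

text \<open>The restriction places the values in a function space with exactly
  \<open>CARD('a) ^ n\<close> elements.\<close>

definition frac_coeffs :: "'a::field fls \<Rightarrow> nat \<Rightarrow> 'a poly \<Rightarrow> nat \<Rightarrow> 'a" where
  "frac_coeffs \<xi> n Q = restrict (\<lambda>i. fls_nth (of_poly_T Q * \<xi>) (int i)) {1..n}"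

lemma frac_coeffs_eq_iff:
  "frac_coeffs \<xi> n P = frac_coeffs \<xi> n Q \<longleftrightarrow>
     (\<forall>i\<in>{1..n}. fls_nth (of_poly_T (P - Q) * \<xi>) (int i) = 0)"
  unfolding frac_coeffs_def restrict_def fun_eq_iff
  by (auto simp: of_poly_T_diff left_diff_distrib)

text \<open>Pigeonhole: \<open>n + 1\<close> free coefficients against \<open>n\<close> conditions
  force a collision, and the difference of the two colliding polynomials is
  \<open>Q\<close>.\<close>

lemma dirichlet_approximation:
  fixes \<xi> :: "'a::{finite, field} fls"
  obtains Q where "Q \<noteq> 0" "degree Q \<le> n"
    "dist_poly (of_poly_T Q * \<xi>) \<le> real CARD('a) powi (- int n - 1)"
proof -
  let ?S = "{P :: 'a poly. \<forall>i\<ge>Suc n. coeff P i = 0}"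
  let ?F = "{1..n} \<rightarrow>\<^sub>E (UNIV :: 'a set)"
  have fin: "finite ?F" by (simp add: finite_PiE)
  have "card ?F < card ?S"
    using one_less_card_field[where 'a = 'a] by (simp add: card_polys_bounded card_PiE)
  moreover have sub: "frac_coeffs \<xi> n ` ?S \<subseteq> ?F"
    by (auto simp: frac_coeffs_def)
  ultimately have "\<not> inj_on (frac_coeffs \<xi> n) ?S"
    using card_inj_on_le[OF _ sub fin] by linarith
  then obtain P R where PR: "P \<in> ?S" "R \<in> ?S" "P \<noteq> R" "frac_coeffs \<xi> n P = frac_coeffs \<xi> n R"
    unfolding inj_on_def by blast
  have "degree (P - R) \<le> n" using PR(1,2) by (intro degree_le) auto
  then show thesis
    using PR(3,4) that[of "P - R"] unfolding frac_coeffs_eq_iff dist_poly_le_powi_iff by simp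
qed

text \<open>
  The bound on \<open>degree R\<close> says that the \<open>m \<times> m\<close> Hankel matrix of \<open>\<xi>\<close> is nonsingular. The number
  \<open>m\<close> is the degree of the convergent denominator that follows \<open>Q\<close>.
\<close>

lemma unbounded_nonsingular:
  fixes \<xi> :: "'a::{finite, field} fls"
  assumes "\<xi> \<notin> rat_funs_T"
  obtains m where "n < m"
    "\<And>R. R \<noteq> 0 \<Longrightarrow> dist_poly (of_poly_T R * \<xi>) \<le> real CARD('a) powi (- int m - 1) \<Longrightarrow> m \<le> degree R"
proof -
  let ?q = "real CARD('a)"
  let ?A = "\<lambda>Q. Q \<noteq> 0 \<and> dist_poly (of_poly_T Q * \<xi>) \<le> ?q powi (- int n - 1)"
  have q: "1 < ?q" by (rule one_less_card_field)
  obtain Q0 where Q0: "?A Q0" "degree Q0 \<le> n"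
    using dirichlet_approximation[of n \<xi>] by metis
  obtain Q where Q: "?A Q" and min: "\<And>R. ?A R \<Longrightarrow> degree Q \<le> degree R"
    using ex_has_least_nat[of ?A Q0 degree] Q0(1) by blast
  \<comment> \<open>Minimality passes the degree bound of \<open>Q0\<close> on to
    \<open>Q\<close>.\<close>
  have deg: "degree Q \<le> n" using min[OF Q0(1)] Q0(2) by simp
  define \<rho> where "\<rho> = of_poly_T Q * \<xi> - of_poly_T (nearest_poly (of_poly_T Q * \<xi>))"
  have \<rho>0: "\<rho> \<noteq> 0"
    using assms rat_funs_T_I[of Q \<xi>] Q by (auto simp: \<rho>_def)
  \<comment> \<open>\<open>nat\<close> loses nothing, since the subdegree turns out to be at least
    \<open>n + 1\<close>.\<close>
  define m where "m = nat (fls_subdegree \<rho>)"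
  have \<rho>_le: "fls_abs \<rho> \<le> ?q powi (- int n - 1)"
    using Q by (simp add: \<rho>_def dist_poly_def)
  then have "int n + 1 \<le> fls_subdegree \<rho>"
    using \<rho>0 power_int_le_iff_exp[OF q] by (simp add: fls_abs_def deg_T_def)
  then have m: "n < m" and \<rho>_abs: "fls_abs \<rho> = ?q powi (- int m)"
    using \<rho>0 by (auto simp: m_def fls_abs_def deg_T_def)
  show thesis
  proof (rule that[OF m])
    fix R assume R: "R \<noteq> 0" "dist_poly (of_poly_T R * \<xi>) \<le> ?q powi (- int m - 1)"
    define \<sigma> where "\<sigma> = of_poly_T R * \<xi> - of_poly_T (nearest_poly (of_poly_T R * \<xi>))"
    have \<sigma>: "fls_abs \<sigma> \<le> ?q powi (- int m - 1)"
      using R by (simp add: \<sigma>_def dist_poly_def)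
    show "m \<le> degree R"
    proof (rule ccontr)
      assume "\<not> m \<le> degree R"
      then have degR: "degree R < m" by simp
      have less: "?q powi i * ?q powi j < 1" if "i + j < 0" for i j
        using power_int_strict_increasing[OF that q] q by (simp add: power_int_add)
      have "fls_abs (of_poly_T Q * \<sigma>) \<le> ?q powi int (degree Q) * ?q powi (- int m - 1)"
        unfolding fls_abs_mult using Q \<sigma> by (intro mult_mono) (auto simp: fls_abs_of_poly_T fls_abs_nonneg)
      also have "\<dots> < 1" using deg m by (intro less) simp
      finally have 1: "fls_abs (of_poly_T Q * \<sigma>) < 1" .
      have 2: "fls_abs (of_poly_T R * \<rho>) < 1"
        using less[of "int (degree R)" "- int m"] degR R
        by (simp add: fls_abs_mult \<rho>_abs fls_abs_of_poly_T)
      \<comment> \<open>The determinant of the two approximations: \<open>\<xi>\<close> cancels from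
        \<open>Q * \<sigma> - R * \<rho>\<close>, leaving a polynomial of absolute value below 1,
        hence 0.\<close>
      define D where "D = R * nearest_poly (of_poly_T Q * \<xi>) - Q * nearest_poly (of_poly_T R * \<xi>)"
      have D: "of_poly_T D = of_poly_T Q * \<sigma> + - (of_poly_T R * \<rho>)"
        by (simp add: D_def \<sigma>_def \<rho>_def of_poly_T_diff of_poly_T_mult algebra_simps)
      have "fls_abs (of_poly_T D) < 1"
        using fls_abs_add_le[of "of_poly_T Q * \<sigma>" "- (of_poly_T R * \<rho>)"] 1 2
        unfolding D by (simp add: fls_abs_minus)
      then have "of_poly_T Q * \<sigma> = of_poly_T R * \<rho>"
        using D of_poly_T_abs_less_1D[of D] by simp
      then have eq: "fls_abs (of_poly_T Q) * fls_abs \<sigma> = fls_abs (of_poly_T R) * fls_abs \<rho>"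
        by (metis fls_abs_mult)
      \<comment> \<open>With equal products, the smaller error must belong to the larger multiplier.
        So \<open>R\<close> has smaller degree than \<open>Q\<close> and is an even better
        approximation, against minimality.\<close>
      have lt: "fls_abs \<sigma> < fls_abs \<rho>"
        using \<sigma> unfolding \<rho>_abs
        by (rule le_less_trans) (intro power_int_strict_increasing q, simp)
      have "\<not> degree Q \<le> degree R"
      proof
        assume "degree Q \<le> degree R"
        then have "fls_abs (of_poly_T Q) \<le> fls_abs (of_poly_T R)"
          using Q R q by (simp add: fls_abs_of_poly_T power_increasing)
        then have "fls_abs (of_poly_T Q) * fls_abs \<sigma> \<le> fls_abs (of_poly_T R) * fls_abs \<sigma>"
          by (intro mult_right_mono fls_abs_nonneg)
        also have "\<dots> < fls_abs (of_poly_T R) * fls_abs \<rho>"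
          using lt R by (intro mult_strict_left_mono) (auto simp: fls_abs_pos_iff)
        finally show False using eq by simp
      qed
      moreover have "?A R"
        using R lt \<rho>_le by (auto simp: dist_poly_def \<sigma>_def)
      ultimately show False using min by blast
    qed
  qed
qed

section \<open>Inhomogeneous approximation\<close>

lemma inhomogeneous_solution:
  fixes \<xi> \<alpha> :: "'a::{finite, field} fls"
  assumes "\<And>R. R \<noteq> 0 \<Longrightarrow> dist_poly (of_poly_T R * \<xi>) \<le> real CARD('a) powi (- int m - 1) \<Longrightarrow> m \<le> degree R"
    and "0 < m"
  obtains Q where "degree Q < m"
    "dist_poly (of_poly_T Q * \<xi> - \<alpha>) \<le> real CARD('a) powi (- int m - 1)"
proof -
  let ?S = "{P :: 'a poly. \<forall>i\<ge>m. coeff P i = 0}"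
  let ?F = "{1..m} \<rightarrow>\<^sub>E (UNIV :: 'a set)"
  \<comment> \<open>Here \<open>0 < m\<close> matters: the zero polynomial has degree 0.\<close>
  have deg: "degree P < m" if "P \<in> ?S" for P
    using degree_le[of "m - 1" P] that assms(2) by auto
  have "inj_on (frac_coeffs \<xi> m) ?S"
  proof (rule inj_onI, rule ccontr)
    fix P R assume PR: "P \<in> ?S" "R \<in> ?S" "frac_coeffs \<xi> m P = frac_coeffs \<xi> m R" "P \<noteq> R"
    have "m \<le> degree (P - R)"
      using assms(1)[of "P - R"] PR(3,4) unfolding frac_coeffs_eq_iff dist_poly_le_powi_iff by simp
    with deg[of "P - R"] PR(1,2) show False by auto
  qed
  moreover have "frac_coeffs \<xi> m ` ?S \<subseteq> ?F"
    by (auto simp: frac_coeffs_def)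
  ultimately have "frac_coeffs \<xi> m ` ?S = ?F"
    by (intro card_subset_eq) (auto simp: finite_PiE card_PiE card_image card_polys_bounded)
  \<comment> \<open>The target is the coefficient vector of \<open>\<alpha>\<close>; a preimage
    \<open>Q\<close> cancels the first \<open>m\<close> fractional coefficients.\<close>
  moreover have "restrict (\<lambda>i. fls_nth \<alpha> (int i)) {1..m} \<in> ?F" by auto
  ultimately obtain Q where Q: "Q \<in> ?S" "frac_coeffs \<xi> m Q = restrict (\<lambda>i. fls_nth \<alpha> (int i)) {1..m}"
    by (metis (no_types, lifting) imageE)
  have "fls_nth (of_poly_T Q * \<xi> - \<alpha>) (int i) = 0" if "i \<in> {1..m}" for i
    using fun_cong[OF Q(2), of i] that by (simp add: frac_coeffs_def)
  then show thesis
    using that[OF deg[OF Q(1)]] unfolding dist_poly_le_powi_iff by blast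
qed

lemma infinite_inhomogeneous_solutions:
  fixes \<xi> \<alpha> :: "'a::{finite, field} fls"
  assumes \<xi>: "\<xi> \<notin> rat_funs_T"
    and \<alpha>: "\<alpha> \<notin> {of_poly_T A + of_poly_T B * \<xi> | A B. True}"
  shows "infinite {Q :: 'a poly. Q \<noteq> 0 \<and>
           dist_poly (of_poly_T Q * \<xi> - \<alpha>) \<le> 1 / (real CARD('a) ^ 2 * fls_abs (of_poly_T Q))}"
    (is "infinite ?S")
proof
  let ?q = "real CARD('a)"
  let ?d = "\<lambda>Q. dist_poly (of_poly_T Q * \<xi> - \<alpha>)"
  assume fin: "finite ?S"
  have q: "1 < ?q" by (rule one_less_card_field)
  have pos: "0 < ?d Q" for Q
  proof (rule dist_poly_pos)
    fix P
    have "\<alpha> \<noteq> of_poly_T (- P) + of_poly_T Q * \<xi>" using \<alpha> by blast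
    then show "of_poly_T Q * \<xi> - \<alpha> \<noteq> of_poly_T P"
      using of_poly_T_diff[of 0 P] by (auto simp: algebra_simps)
  qed
  \<comment> \<open>If there were finitely many solutions, their distances would have a positive
    minimum, which a large \<open>m\<close> undercuts. Inserting 0 keeps the set nonempty and forces
    the new \<open>Q\<close> to be nonzero.\<close>
  define \<epsilon> where "\<epsilon> = Min (?d ` insert 0 ?S)"
  have \<epsilon>: "0 < \<epsilon>"
    unfolding \<epsilon>_def using fin pos[of 0] pos by (subst Min_gr_iff) auto
  have le: "\<epsilon> \<le> ?d Q" if "Q \<in> insert 0 ?S" for Q
    unfolding \<epsilon>_def using fin that by (intro Min_le finite_imageI imageI) auto
  obtain n where n: "(1 / ?q) ^ n < \<epsilon>"
    using real_arch_pow_inv[of \<epsilon> "1 / ?q"] \<epsilon> q by auto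
  obtain m where m: "n < m" "\<And>R. R \<noteq> 0 \<Longrightarrow> dist_poly (of_poly_T R * \<xi>) \<le> ?q powi (- int m - 1) \<Longrightarrow> m \<le> degree R"
    using unbounded_nonsingular[OF \<xi>, of n] by metis
  obtain Q where Q: "degree Q < m" "?d Q \<le> ?q powi (- int m - 1)"
    using inhomogeneous_solution[of \<xi> m \<alpha>] m by (metis gr_zeroI not_less_zero)
  have "?q powi (- int m - 1) \<le> ?q powi (- int n)"
    using q m(1) by (intro power_int_increasing) auto
  also have "\<dots> = (1 / ?q) ^ n" by (simp add: power_int_minus power_one_over divide_simps)
  finally have "?d Q < \<epsilon>" using Q(2) n by linarith
  then have "Q \<notin> insert 0 ?S" using le[of Q] by linarith
  then have Q0: "Q \<noteq> 0" and notin: "Q \<notin> ?S" by auto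
  \<comment> \<open>The factor \<open>q^2\<close> arises here: \<open>degree Q < m\<close> gives
    \<open>degree Q + 2 \<le> m + 1\<close>.\<close>
  have "?q powi (- int m - 1) \<le> ?q powi (- int (2 + degree Q))"
    using q Q(1) by (intro power_int_increasing) auto
  also have "\<dots> = 1 / (?q ^ 2 * fls_abs (of_poly_T Q))"
    unfolding fls_abs_of_poly_T[OF Q0]
    by (simp only: power_int_minus power_int_of_nat power_add inverse_eq_divide)
  finally show False using notin Q0 Q(2) by auto
qed

section \<open>The extremal quadratic irrational\<close>

text \<open>Coefficients of the power series solution of \<open>g = X - X * g^2\<close>, which is
  \<open>x^2 + T x = 1\<close> multiplied by \<open>X = 1/T\<close>.\<close>

fun quad_coeff :: "nat \<Rightarrow> 'a::field" where
  "quad_coeff 0 = 0"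
| "quad_coeff (Suc n) = (if n = 0 then 1 else 0) - (\<Sum>i\<le>n. quad_coeff i * quad_coeff (n - i))"

text \<open>The root \<open>[0; T, T, T, \<dots>]\<close> of \<open>x\<^sup>2 + T x = 1\<close>.\<close>

definition quad_irrational :: "'a::field fls" where
  "quad_irrational = fps_to_fls (Abs_fps quad_coeff)"

lemma quad_irrational_equation:
  "quad_irrational * quad_irrational + fls_X_inv * quad_irrational = (1 :: 'a::field fls)"
proof -
  define g :: "'a fps" where "g = Abs_fps quad_coeff"
  have "fps_nth (fps_X * (g * g) + g) n = fps_nth fps_X n" for n
  proof (cases n)
    case (Suc k)
    have "fps_nth (g * g) k = (\<Sum>i\<le>k. quad_coeff i * quad_coeff (k - i))"
      by (simp add: g_def fps_mult_nth atLeast0AtMost)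
    then show ?thesis by (simp add: Suc) (simp add: g_def)
  qed (simp add: g_def)
  then have "fps_X * (g * g) + g = fps_X" by (rule fps_ext)
  then have "fps_to_fls (fps_X * (g * g) + g) = fps_to_fls fps_X" by simp
  then have "fls_X * (quad_irrational * quad_irrational) + quad_irrational = (fls_X :: 'a fls)"
    by (simp add: quad_irrational_def g_def fls_times_fps_to_fls fps_to_fls_plus)
  then have "fls_X_inv * (fls_X * (quad_irrational * quad_irrational) + quad_irrational) =
      fls_X_inv * (fls_X :: 'a fls)" by simp
  then show ?thesis by (simp add: distrib_left mult.assoc[symmetric] fls_X_inv_times_X)
qed

lemma quad_irrational_abs: "fls_abs (quad_irrational :: 'a::{finite, field} fls) < 1"
  by (auto simp: fls_abs_less_1_iff quad_irrational_def)

text \<open>Infinite descent: if \<open>x = A / B\<close>, the equation gives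
  \<open>x = 1/x - T = (B - T A) / A\<close>, and \<open>|x| < 1\<close> makes the new denominator
  \<open>A\<close> of smaller degree.\<close>

lemma quad_irrational_no_quotient:
  fixes A B :: "'a::{finite, field} poly"
  assumes "of_poly_T B * quad_irrational = of_poly_T A"
  shows "B = 0"
  using assms
proof (induction "degree B" arbitrary: A B rule: less_induct)
  case less
  let ?x = "quad_irrational :: 'a fls"
  show ?case
  proof (rule ccontr)
    assume B: "B \<noteq> 0"
    have x0: "?x \<noteq> 0" using quad_irrational_equation[where 'a = 'a] by auto
    then have A: "A \<noteq> 0" using B less.prems by auto
    have "fls_abs (of_poly_T A) < fls_abs (of_poly_T B)"
      using less.prems[symmetric] quad_irrational_abs[where 'a = 'a] B
      by (simp add: fls_abs_mult fls_abs_pos_iff)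
    then have "degree A < degree B"
      using A B one_less_card_field[where 'a = 'a] by (simp add: fls_abs_of_poly_T)
    moreover have "of_poly_T A * ?x = of_poly_T (B - pCons 0 A)"
    proof -
      have "of_poly_T B * (?x * ?x + fls_X_inv * ?x) = of_poly_T B"
        by (simp add: quad_irrational_equation)
      then show ?thesis
        by (simp add: less.prems[symmetric] of_poly_T_diff of_poly_T_pCons algebra_simps)
    qed
    ultimately show False using less.hyps A by blast
  qed
qed

lemma quad_irrational_congruent_approximation:
  fixes P Q :: "'a::{finite, field} poly"
  defines "A \<equiv> pCons 1 P" and "B \<equiv> pCons 1 Q"
  shows "1 \<le> fls_abs (of_poly_T B) * fls_abs (of_poly_T A - of_poly_T B * quad_irrational)"
proof (rule ccontr)
  let ?q = "real CARD('a)"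
  let ?x = "quad_irrational :: 'a fls"
  define \<delta> where "\<delta> = of_poly_T A - of_poly_T B * ?x"
  \<comment> \<open>\<open>\<delta>'\<close> is the conjugate of \<open>\<delta>\<close>, as the two roots of the equation add up to \<open>-T\<close>\<close>
  define \<delta>' where "\<delta>' = of_poly_T A + of_poly_T B * (fls_X_inv + ?x)"
  assume "\<not> ?thesis"
  then have lt: "fls_abs (of_poly_T B) * fls_abs \<delta> < 1" by (simp add: \<delta>_def)
  have q: "1 < ?q" by (rule one_less_card_field)
  have B0: "B \<noteq> 0" by (simp add: B_def)
  then have B1: "1 \<le> fls_abs (of_poly_T B)"
    using of_poly_T_abs_less_1D[of B] by (meson not_le)
  have "fls_abs \<delta> \<le> fls_abs (of_poly_T B) * fls_abs \<delta>"
    using mult_right_mono[OF B1 fls_abs_nonneg[of \<delta>]] by simp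
  with lt have \<delta>1: "fls_abs \<delta> < 1" by simp
  define N where "N = A * A + pCons 0 (A * B) - B * B"
  have N: "of_poly_T N = \<delta> * \<delta>'"
  proof -
    have "\<delta> * \<delta>' = of_poly_T A * of_poly_T A + of_poly_T A * of_poly_T B * fls_X_inv
        - of_poly_T B * of_poly_T B * (?x * ?x + fls_X_inv * ?x)"
      by (simp add: \<delta>_def \<delta>'_def algebra_simps)
    then show ?thesis
      unfolding quad_irrational_equation
      by (simp add: N_def of_poly_T_diff of_poly_T_add of_poly_T_mult
          of_poly_T_pCons algebra_simps)
  qed
  \<comment> \<open>The conjugates differ by \<open>B (T + 2x)\<close>, so \<open>\<delta>'\<close>
    has size at most \<open>q |B|\<close>.\<close>
  have "fls_abs (fls_X_inv + (?x + ?x)) \<le> ?q"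
    using fls_abs_add_le[of fls_X_inv "?x + ?x"] fls_abs_add_le[of ?x ?x]
      quad_irrational_abs[where 'a = 'a] q by (simp add: fls_abs_X_inv)
  then have "fls_abs (of_poly_T B * (fls_X_inv + (?x + ?x))) \<le> fls_abs (of_poly_T B) * ?q"
    by (simp add: fls_abs_mult mult_left_mono fls_abs_nonneg)
  moreover have "fls_abs \<delta> \<le> fls_abs (of_poly_T B) * ?q"
    using \<delta>1 mult_mono[of 1 "fls_abs (of_poly_T B)" 1 ?q] B1 q by simp
  moreover have "\<delta>' = \<delta> + of_poly_T B * (fls_X_inv + (?x + ?x))"
    by (simp add: \<delta>_def \<delta>'_def algebra_simps)
  ultimately have "fls_abs \<delta>' \<le> fls_abs (of_poly_T B) * ?q"
    using fls_abs_add_le[of \<delta> "of_poly_T B * (fls_X_inv + (?x + ?x))"] by simp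
  then have "fls_abs (of_poly_T N) \<le> fls_abs \<delta> * (fls_abs (of_poly_T B) * ?q)"
    unfolding N fls_abs_mult by (intro mult_left_mono fls_abs_nonneg)
  also have "\<dots> < ?q" using mult_strict_right_mono[OF lt, of ?q] q by (simp add: mult_ac)
  finally have Nq: "fls_abs (of_poly_T N) < ?q" .
  obtain c M where cM: "N = pCons c M" by (cases N)
  \<comment> \<open>The constant terms of \<open>A\<close> and \<open>B\<close> are both 1, so those
    of \<open>A^2\<close> and \<open>B^2\<close> cancel. This divisibility by \<open>T\<close> gains
    the factor \<open>q\<close> over the plain norm bound.\<close>
  have "coeff N 0 = 0" by (simp add: N_def A_def B_def)
  then have M: "N = pCons 0 M" using cM by simp
  have "fls_abs (of_poly_T M) < 1"
    using Nq q by (simp add: M of_poly_T_pCons fls_abs_mult fls_abs_X_inv)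
  then have "M = 0" by (rule of_poly_T_abs_less_1D)
  then have "of_poly_T N = 0" by (simp add: M)
  then consider "\<delta> = 0" | "\<delta>' = 0" unfolding N by auto
  then show False
  proof cases
    case 1
    then have "of_poly_T B * ?x = of_poly_T A" by (simp add: \<delta>_def)
    then show False using quad_irrational_no_quotient[of B A] B0 by simp
  next
    \<comment> \<open>The conjugate root \<open>-T - x\<close> would be \<open>A / B\<close>, making
      \<open>x\<close> rational as well.\<close>
    case 2
    then have "of_poly_T B * ?x = of_poly_T (0 - A - pCons 0 B)"
      unfolding of_poly_T_diff \<delta>'_def
      by (simp add: of_poly_T_pCons eq_neg_iff_add_eq_0 eq_diff_eq algebra_simps)
    then show False using quad_irrational_no_quotient[of B "0 - A - pCons 0 B"] B0 by simp
  qed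
qed

text \<open>The inhomogeneous term is chosen so that multiplication by \<open>T\<close> adds 1 to
  both \<open>T P\<close> and \<open>T Q\<close>. One factor \<open>q\<close> is \<open>|T|\<close>;
  the other comes from \<open>|T Q + 1| = q |Q|\<close>, valid as \<open>Q\<close> is
  nonzero.\<close>

lemma quad_irrational_badly_approximable:
  fixes Q :: "'a::{finite, field} poly"
  assumes "Q \<noteq> 0"
  shows "1 / (real CARD('a) ^ 2 * fls_abs (of_poly_T Q))
           \<le> dist_poly (of_poly_T Q * quad_irrational - fls_X * (1 - quad_irrational))"
proof -
  let ?q = "real CARD('a)"
  let ?x = "quad_irrational :: 'a fls"
  define y where "y = of_poly_T Q * ?x - fls_X * (1 - ?x)"
  define P where "P = nearest_poly y"
  have q: "1 < ?q" by (rule one_less_card_field)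
  have "of_poly_T (pCons 1 P) - of_poly_T (pCons 1 Q) * ?x = - (fls_X_inv * (y - of_poly_T P))"
  proof -
    have "fls_X_inv * (fls_X * (1 - ?x)) = 1 - ?x"
      by (simp add: mult.assoc[symmetric] fls_X_inv_times_X)
    then show ?thesis
      by (simp add: y_def of_poly_T_pCons right_diff_distrib) (simp add: algebra_simps)
  qed
  then have "fls_abs (of_poly_T (pCons 1 P) - of_poly_T (pCons 1 Q) * ?x) = ?q * dist_poly y"
    by (simp add: fls_abs_minus fls_abs_mult fls_abs_X_inv dist_poly_def P_def)
  moreover have "fls_abs (of_poly_T (pCons 1 Q)) = ?q * fls_abs (of_poly_T Q)"
    using assms by (simp add: fls_abs_of_poly_T)
  ultimately have "1 \<le> ?q * fls_abs (of_poly_T Q) * (?q * dist_poly y)"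
    using quad_irrational_congruent_approximation[of Q P] by simp
  moreover have "0 < fls_abs (of_poly_T Q)" using assms by (simp add: fls_abs_pos_iff)
  ultimately show ?thesis
    using q unfolding y_def[symmetric] by (simp add: field_simps power2_eq_square)
qed

lemma quad_irrational_not_rational: "(quad_irrational :: 'a::{finite, field} fls) \<notin> rat_funs_T"
proof
  assume "(quad_irrational :: 'a fls) \<in> rat_funs_T"
  then obtain A B :: "'a poly" where "quad_irrational = of_poly_T A / of_poly_T B" "B \<noteq> 0"
    unfolding rat_funs_T_def by blast
  then show False using quad_irrational_no_quotient[of B A] by (simp add: field_simps)
qed

theorem theorem1p1:
  shows "(\<forall>\<xi> \<alpha> :: 'a::{finite, field} fls.
            \<xi> \<notin> rat_funs_T \<longrightarrow>
            \<alpha> \<notin> {of_poly_T A + of_poly_T B * \<xi> | A B. True} \<longrightarrow>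
            infinite {Q :: 'a poly. Q \<noteq> 0 \<and>
              dist_poly (of_poly_T Q * \<xi> - \<alpha>)
                \<le> 1 / (real CARD('a) ^ 2 * fls_abs (of_poly_T Q))})
       \<and> (\<exists>\<xi> :: 'a fls.
            fls_abs \<xi> < 1 \<and> \<xi> \<notin> rat_funs_T \<and>
            (\<forall>Q :: 'a poly. Q \<noteq> 0 \<longrightarrow>
              dist_poly (of_poly_T Q * \<xi> - fls_X * (1 - \<xi>))
                \<ge> 1 / (real CARD('a) ^ 2 * fls_abs (of_poly_T Q))))"
proof (intro conjI allI impI exI[of _ quad_irrational])
  fix \<xi> \<alpha> :: "'a fls"
  assume "\<xi> \<notin> rat_funs_T" "\<alpha> \<notin> {of_poly_T A + of_poly_T B * \<xi> | A B. True}"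
  then show "infinite {Q :: 'a poly. Q \<noteq> 0 \<and>
      dist_poly (of_poly_T Q * \<xi> - \<alpha>) \<le> 1 / (real CARD('a) ^ 2 * fls_abs (of_poly_T Q))}"
    by (rule infinite_inhomogeneous_solutions)
qed (fact quad_irrational_abs quad_irrational_not_rational quad_irrational_badly_approximable)+

end
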